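(* Let $Y$ be a reduced irreducible affine variety over $\mathbb{C}$, $A=\mathbb{C}[Y]$, $I\subseteq A$ a non-trivial ideal, $f\in I$ a nonzero element, $A'=A[I/f]$ and $X={\rm spec}\,A'$ the affine modification of $Y$ along $f^*(0)$ with center $I$. Let $D_1,\dots,D_n$ (resp. $E_1,\dots,E_{n'}$) be the irreducible components of $D=f^{-1}(0)\subset Y$ (resp. of $E=\sigma^{-1}(D)\subset X$), assumed to be Cartier divisors, and let $M_\sigma$ be the $n\times n'$ multiplicity matrix. Assume that the algebras $A=\mathbb{C}[Y]$ and $A'=\mathbb{C}[X]$ are UFDs and that $A^*=A'^*$. Then $n=n'$ and the multiplicity matrix $M_\sigma$ is unimodular.
   Context: $A[I/f]=\{a_k/f^k\mid a_k\in I^k\}\subseteq{\rm Frac}\,A$; the inclusion $A\hookrightarrow A'$ corresponds to a birational morphism $\sigma:X\to Y$. The multiplicity matrix $M_\sigma=(m_{ij})$ is defined by $\sigma^*(D_i)=\sum_{j=1}^{n'}m_{ij}E_j$, $i=1,\dots,n$ ($D_i$, $E_j$ reduced). $A^*$ denotes the group of invertible elements of $A$. Unimodular means that the matrix is square and invertible over $\mathbb{Z}$. *)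

theory Defs
  imports
    "HOL-Algebra.Algebra"
    "HOL-Algebra.Algebraic_Closure_Type"
    "HOL-Analysis.Abstract_Topology"
    "Jordan_Normal_Form.Matrix"
begin

section \<open>Coordinate algebras and affine modifications\<close>

definition affine_variety_algebra :: "('a, 'b) ring_scheme \<Rightarrow> (complex \<Rightarrow> 'a) \<Rightarrow> bool" where
  "affine_variety_algebra R \<phi> \<longleftrightarrow>
     domain R \<and>
     \<phi> \<in> Ring.ring_hom (ring_of_type_algebra :: complex ring) R \<and>
     (\<exists>S. finite S \<and> S \<subseteq> carrier R \<and> carrier R = generate_ring R (range \<phi> \<union> S))"

definition is_fraction_field_of :: "('a, 'b) ring_scheme \<Rightarrow> 'a set \<Rightarrow> bool" where
  "is_fraction_field_of F A \<longleftrightarrow>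
     field F \<and> subring A F \<and>
     carrier F = {a \<otimes>\<^bsub>F\<^esub> inv\<^bsub>F\<^esub> b | a b. a \<in> A \<and> b \<in> A - {\<zero>\<^bsub>F\<^esub>}}"

text \<open>
  Powers of ideals are powers in the monoid \<^const>\<open>ideals_set\<close>, whose unit is the whole ring;
  so the zeroth power of \<open>I\<close> is \<open>A\<close>.
\<close>

definition affine_modification :: "('a, 'b) ring_scheme \<Rightarrow> 'a set \<Rightarrow> 'a set \<Rightarrow> 'a \<Rightarrow> 'a set" where
  "affine_modification F A I f =
     {a \<otimes>\<^bsub>F\<^esub> inv\<^bsub>F\<^esub> (f [^]\<^bsub>F\<^esub> k) | a (k::nat).
        a \<in> I [^]\<^bsub>ideals_set (F\<lparr>carrier := A\<rparr>)\<^esub> k}"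

section \<open>Prime spectra and irreducible components\<close>

definition spec :: "('a, 'b) ring_scheme \<Rightarrow> 'a set set" where
  "spec R = {P. primeideal P R}"

definition zariski :: "('a, 'b) ring_scheme \<Rightarrow> 'a set topology" where
  "zariski R = topology (\<lambda>U. \<exists>S \<subseteq> carrier R. U = {P \<in> spec R. \<not> S \<subseteq> P})"

lemma istopology_zariski:
  "istopology (\<lambda>U. \<exists>S \<subseteq> carrier R. U = {P \<in> spec R. \<not> S \<subseteq> P})"
  unfolding istopology_def
proof (intro conjI allI impI)
  fix U V
  assume "\<exists>S \<subseteq> carrier R. U = {P \<in> spec R. \<not> S \<subseteq> P}"
    and "\<exists>S \<subseteq> carrier R. V = {P \<in> spec R. \<not> S \<subseteq> P}"
  then obtain S T where S: "S \<subseteq> carrier R" "U = {P \<in> spec R. \<not> S \<subseteq> P}"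
    and T: "T \<subseteq> carrier R" "V = {P \<in> spec R. \<not> T \<subseteq> P}" by blast
  let ?W = "{s \<otimes>\<^bsub>R\<^esub> t | s t. s \<in> S \<and> t \<in> T}"
  have *: "\<not> ?W \<subseteq> P \<longleftrightarrow> \<not> S \<subseteq> P \<and> \<not> T \<subseteq> P" if "P \<in> spec R" for P
  proof -
    interpret primeideal P R using that by (simp add: spec_def)
    show ?thesis
    proof
      assume "\<not> ?W \<subseteq> P"
      then obtain s t where "s \<in> S" "t \<in> T" "s \<otimes>\<^bsub>R\<^esub> t \<notin> P" by blast
      then show "\<not> S \<subseteq> P \<and> \<not> T \<subseteq> P"
        using I_l_closed I_r_closed S(1) T(1) by blast
    next
      assume "\<not> S \<subseteq> P \<and> \<not> T \<subseteq> P"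
      then obtain s t where "s \<in> S" "t \<in> T" "s \<notin> P" "t \<notin> P" by blast
      moreover from this have "s \<otimes>\<^bsub>R\<^esub> t \<notin> P" using I_prime S(1) T(1) by blast
      ultimately show "\<not> ?W \<subseteq> P" by blast
    qed
  qed
  show "\<exists>W \<subseteq> carrier R. U \<inter> V = {P \<in> spec R. \<not> W \<subseteq> P}"
  proof (cases "spec R = {}")
    case True
    then show ?thesis using S(2) by blast
  next
    case False
    then obtain Q where "primeideal Q R" by (auto simp: spec_def)
    then interpret primeideal Q R .
    have "?W \<subseteq> carrier R" using S(1) T(1) by blast
    moreover have "U \<inter> V = {P \<in> spec R. \<not> ?W \<subseteq> P}" using * S(2) T(2) by blast
    ultimately show ?thesis by blast
  qed
next
  fix \<K>
  assume "\<forall>K\<in>\<K>. \<exists>S \<subseteq> carrier R. K = {P \<in> spec R. \<not> S \<subseteq> P}"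
  then obtain S where S: "\<And>K. K \<in> \<K> \<Longrightarrow> S K \<subseteq> carrier R"
    "\<And>K. K \<in> \<K> \<Longrightarrow> K = {P \<in> spec R. \<not> S K \<subseteq> P}" by metis
  have mem: "P \<in> K \<longleftrightarrow> P \<in> spec R \<and> \<not> S K \<subseteq> P" if "K \<in> \<K>" for P K
    using S(2)[OF that] by blast
  have "\<Union>\<K> = {P \<in> spec R. \<not> (\<Union>K\<in>\<K>. S K) \<subseteq> P}" (is "_ = ?V")
  proof
    show "\<Union>\<K> \<subseteq> ?V" using mem by blast
    show "?V \<subseteq> \<Union>\<K>" using mem by blast
  qed
  moreover have "(\<Union>K\<in>\<K>. S K) \<subseteq> carrier R" using S(1) by blast
  ultimately show "\<exists>S \<subseteq> carrier R. \<Union>\<K> = {P \<in> spec R. \<not> S \<subseteq> P}" by blast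
qed

definition irreducible_subspace :: "'a topology \<Rightarrow> 'a set \<Rightarrow> bool" where
  "irreducible_subspace T S \<longleftrightarrow>
     S \<subseteq> topspace T \<and> S \<noteq> {} \<and>
     (\<forall>C C'. closedin (subtopology T S) C \<and> closedin (subtopology T S) C' \<and> C \<union> C' = S
        \<longrightarrow> C = S \<or> C' = S)"

definition irreducible_components :: "'a topology \<Rightarrow> 'a set \<Rightarrow> 'a set set" where
  "irreducible_components T D =
     {Z. irreducible_subspace T Z \<and> Z \<subseteq> D \<and>
         (\<forall>W. irreducible_subspace T W \<and> Z \<subseteq> W \<and> W \<subseteq> D \<longrightarrow> W = Z)}"

definition zero_locus :: "('a, 'b) ring_scheme \<Rightarrow> 'a \<Rightarrow> 'a set set" where
  "zero_locus R f = {P \<in> spec R. f \<in> P}"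

text \<open>The morphism of spectra induced by the inclusion of a subring \<open>A\<close>: contraction of primes.\<close>

definition contraction :: "'a set \<Rightarrow> 'a set \<Rightarrow> 'a set" where
  "contraction A Q = Q \<inter> A"

definition vanishing_ideal :: "('a, 'b) ring_scheme \<Rightarrow> 'a set set \<Rightarrow> 'a set" where
  "vanishing_ideal R Z = {x \<in> carrier R. \<forall>P\<in>Z. x \<in> P}"

section \<open>Cartier divisors and the multiplicity matrix\<close>

text \<open>
  An effective Cartier divisor on \<open>spec R\<close>, for a domain \<open>R\<close>, is represented by its ideal \<open>J\<close>:
  around every point \<open>P\<close> there is a basic open set, where some \<open>s \<notin> P\<close> is inverted, on which \<open>J\<close>
  is generated by one nonzero element \<open>g\<close>. As \<open>s\<close> becomes a unit, \<open>g\<close> may be taken in \<open>J\<close>, and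
  \<open>x\<close> lies in the ideal generated by \<open>g\<close> in the localization iff \<open>s^k x\<close> lies in \<open>(g)\<close> for
  some \<open>k\<close>.
\<close>

definition effective_cartier :: "('a, 'b) ring_scheme \<Rightarrow> 'a set \<Rightarrow> bool" where
  "effective_cartier R J \<longleftrightarrow>
     ideal J R \<and>
     (\<forall>P \<in> spec R. \<exists>s \<in> carrier R - P. \<exists>g \<in> J - {\<zero>\<^bsub>R\<^esub>}.
        \<forall>x \<in> J. \<exists>k::nat. s [^]\<^bsub>R\<^esub> k \<otimes>\<^bsub>R\<^esub> x \<in> PIdl\<^bsub>R\<^esub> g)"

text \<open>
  A closed subset carries its reduced structure, given by its vanishing ideal. Addition of
  effective Cartier divisors is multiplication of ideals, so the following is the ideal of
  \<open>m\<^sub>0 E\<^sub>0 + \<dots> + m\<^bsub>n-1\<^esub> E\<^bsub>n-1\<^esub>\<close>.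
\<close>

definition divisor_ideal ::
  "('a, 'b) ring_scheme \<Rightarrow> nat \<Rightarrow> (nat \<Rightarrow> 'a set set) \<Rightarrow> (nat \<Rightarrow> nat) \<Rightarrow> 'a set" where
  "divisor_ideal R n E m =
     finprod (ideals_set R) (\<lambda>j. vanishing_ideal R (E j) [^]\<^bsub>ideals_set R\<^esub> m j) {..<n}"

text \<open>Pulling an effective Cartier divisor back along \<open>spec R' \<rightarrow> spec R\<close> is extension of ideals.\<close>

definition pullback_ideal :: "('a, 'c) ring_scheme \<Rightarrow> 'a set \<Rightarrow> 'a set" where
  "pullback_ideal R' J = Idl\<^bsub>R'\<^esub> J"

text \<open>
  The \<open>n \<times> n'\<close> matrix \<open>M\<close> with \<open>\<sigma>\<^sup>* D\<^sub>i = \<Sum>\<^sub>j M\<^sub>i\<^sub>j E\<^sub>j\<close> for all \<open>i\<close>. Its entries are natural numbers,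
  since the pullback of an effective divisor is effective; it is then viewed as an integer matrix.
\<close>

definition multiplicity_matrix ::
  "('a, 'b) ring_scheme \<Rightarrow> ('a, 'c) ring_scheme \<Rightarrow> nat \<Rightarrow> (nat \<Rightarrow> 'a set set) \<Rightarrow>
   nat \<Rightarrow> (nat \<Rightarrow> 'a set set) \<Rightarrow> int mat" where
  "multiplicity_matrix R R' n D n' E = map_mat int
     (THE M. M \<in> carrier_mat n n' \<and>
        (\<forall>i<n. pullback_ideal R' (vanishing_ideal R (D i)) =
               divisor_ideal R' n' E (\<lambda>j. M $$ (i, j))))"

end

theory Submission
  imports Defs
begin

text \<open>
  Let \<open>F\<close> be the fraction field of \<open>A\<close>. In a factorial domain the irreducible components of the zero
  locus of \<open>f\<close> are the zero loci of the prime divisors of \<open>f\<close>, and the ideal of each is generated by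
  that prime. So the divisors \<open>D i\<close> are given by primes \<open>p i\<close> of \<open>A\<close>, and the divisors \<open>E j\<close>, which are
  the components of the zero locus of \<open>f\<close> upstairs, by primes \<open>q j\<close> of \<open>A'\<close>. In these terms the
  multiplicity matrix is the matrix of exponents \<open>m i j\<close> in the factorization of \<open>p i\<close>, a divisor
  of \<open>f\<close>, into the primes \<open>q j\<close> of \<open>A'\<close>, up to a unit of \<open>A'\<close>
  (\<open>prime_equations_of_components\<close> and \<open>multiplicity_matrix_eqI\<close>).

  An affine modification is an isomorphism away from the divisor of \<open>f\<close>: one has
  \<open>A \<subseteq> A' \<subseteq> A[1/f]\<close>, so \<open>A\<close> and \<open>A'\<close> have the same localization at \<open>f\<close>. As \<open>q j\<close> divides \<open>f\<close>
  in \<open>A'\<close>, it is a unit of \<open>A[1/f]\<close>, hence a product of powers of the \<open>p i\<close> with integer exponents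
  \<open>N j i\<close>, up to a unit of \<open>A\<close> (\<open>quotient_by_power_eq_monomial\<close>).

  Let \<open>U\<close> be the common group of units of \<open>A\<close> and \<open>A'\<close>. By unique factorization the \<open>p i\<close> are
  independent modulo \<open>U\<close> in the multiplicative group of \<open>F\<close>, and so are the \<open>q j\<close>
  (\<open>prime_divisor_system_independent\<close>). Thus both families are bases of one free abelian group, the
  units of \<open>A[1/f]\<close> modulo \<open>U\<close>, and the multiplicity matrix is the matrix of a change of basis,
  with inverse \<open>N\<close> (\<open>change_of_basis_inverse\<close>). If \<open>A'\<close> had more units than \<open>A\<close>, the relation
  expressing \<open>p i\<close> through the \<open>q j\<close> would hold only modulo a larger group, in which the \<open>p i\<close> could
  become dependent.
\<close>

section \<open>Monomials in an abelian group and changes of basis\<close>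

definition monomial :: "('a, 'b) monoid_scheme \<Rightarrow> 'i set \<Rightarrow> ('i \<Rightarrow> 'a) \<Rightarrow> ('i \<Rightarrow> int) \<Rightarrow> 'a" where
  "monomial G I p e = finprod G (\<lambda>i. p i [^]\<^bsub>G\<^esub> e i) I"

text \<open>
  The images of the \<open>p i\<close> in the quotient group \<open>G / U\<close> are linearly independent over the integers.
\<close>
definition independent_modulo ::
  "('a, 'b) monoid_scheme \<Rightarrow> 'a set \<Rightarrow> 'i set \<Rightarrow> ('i \<Rightarrow> 'a) \<Rightarrow> bool" where
  "independent_modulo G U I p \<longleftrightarrow> (\<forall>e. monomial G I p e \<in> U \<longrightarrow> (\<forall>i\<in>I. e i = 0))"

context comm_group
begin

lemma monomial_closed [simp]:
  "p \<in> I \<rightarrow> carrier G \<Longrightarrow> monomial G I p e \<in> carrier G"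
  unfolding monomial_def by (intro finprod_closed) auto

lemma monomial_add:
  assumes "p \<in> I \<rightarrow> carrier G"
  shows "monomial G I p (\<lambda>i. d i + e i) = monomial G I p d \<otimes> monomial G I p e"
proof -
  have "monomial G I p (\<lambda>i. d i + e i) = finprod G (\<lambda>i. p i [^] d i \<otimes> p i [^] e i) I"
    unfolding monomial_def using assms by (intro finprod_cong') (auto simp: int_pow_mult Pi_iff)
  also have "\<dots> = monomial G I p d \<otimes> monomial G I p e"
    unfolding monomial_def using assms by (intro finprod_multf) auto
  finally show ?thesis .
qed

lemma monomial_zero: "monomial G I p (\<lambda>i. 0) = \<one>"
  unfolding monomial_def by simp

lemma monomial_minus:
  assumes "p \<in> I \<rightarrow> carrier G"
  shows "monomial G I p (\<lambda>i. - e i) = inv (monomial G I p e)"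
  using monomial_add[OF assms, of "\<lambda>i. - e i" e] assms
  by (intro inv_equality[symmetric]) (auto simp: monomial_zero)

lemma monomial_diff:
  assumes "p \<in> I \<rightarrow> carrier G"
  shows "monomial G I p (\<lambda>i. d i - e i) = monomial G I p d \<otimes> inv (monomial G I p e)"
  using monomial_add[OF assms, of d "\<lambda>i. - e i"] monomial_minus[OF assms] by simp

lemma monomial_scale:
  assumes "p \<in> I \<rightarrow> carrier G"
  shows "monomial G I p (\<lambda>i. c * e i) = monomial G I p e [^] (c::int)"
  using assms unfolding monomial_def
proof (induction I rule: infinite_finite_induct)
  case (insert i I)
  then have "finprod G (\<lambda>i. p i [^] e i) (insert i I) [^] c
      = (p i [^] e i) [^] c \<otimes> finprod G (\<lambda>i. p i [^] e i) I [^] c"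
    by (subst finprod_insert) (auto simp: int_pow_distrib Pi_def)
  also have "(p i [^] e i) [^] c = p i [^] (c * e i)"
    using insert.prems by (simp add: int_pow_pow mult.commute)
  finally show ?case
    using insert by (subst finprod_insert) (auto simp: Pi_def)
qed auto

lemma monomial_unit_vector:
  assumes "finite I" "k \<in> I" "p \<in> I \<rightarrow> carrier G"
  shows "monomial G I p (\<lambda>i. if i = k then 1 else 0) = p k"
proof -
  have "monomial G I p (\<lambda>i. if i = k then 1 else 0)
      = finprod G (\<lambda>i. if i = k then p i else \<one>) I"
    unfolding monomial_def using assms by (intro finprod_cong') (auto simp: Pi_def)
  also have "\<dots> = p k"
    using assms by (intro finprod_singleton_swap) auto
  finally show ?thesis .
qed

lemma monomial_sum:
  assumes "finite J" "p \<in> I \<rightarrow> carrier G"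
  shows "monomial G I p (\<lambda>i. \<Sum>j\<in>J. e j i) = finprod G (\<lambda>j. monomial G I p (e j)) J"
  using assms(1)
proof (induction J rule: finite_induct)
  case (insert j J)
  then show ?case
    using assms(2) by (subst finprod_insert) (auto simp: monomial_add)
qed (simp add: monomial_zero)

lemma finprod_subgroup_closed:
  assumes "subgroup U G" "u \<in> J \<rightarrow> U"
  shows "finprod G u J \<in> U"
  using assms(2)
proof (induction J rule: infinite_finite_induct)
  case (insert j J)
  then show ?case
    using subgroup.mem_carrier[OF assms(1)] subgroup.m_closed[OF assms(1)]
    by (subst finprod_insert) auto
qed (auto simp: subgroup.one_closed[OF assms(1)])

lemma int_pow_subgroup_closed:
  assumes "subgroup U G" "u \<in> U"
  shows "u [^] (k::int) \<in> U"
  using group.int_pow_closed[OF subgroup.subgroup_is_group[OF assms(1) is_group], of u k]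
    int_pow_consistent[OF assms] assms(2) by simp

text \<open>
  Write \<open>G\<close> additively. Modulo \<open>U\<close>, substituting the expressions for the \<open>q j\<close> into the expression
  for \<open>p i\<close> writes \<open>p i\<close> as a combination of the \<open>p k\<close> whose coefficients are row \<open>i\<close> of the matrix
  product \<open>M N\<close>. Independence allows only the trivial such expression, so \<open>M N\<close> is the identity.
  If the \<open>q j\<close> are independent as well, exchanging the roles of the families gives \<open>N M\<close>.
\<close>
lemma change_of_basis_inverse:
  assumes U: "subgroup U G"
    and fin: "finite I" "finite J"
    and p: "p \<in> I \<rightarrow> carrier G" and q: "q \<in> J \<rightarrow> carrier G"
    and indep: "independent_modulo G U I p"
    and M: "\<And>i. i \<in> I \<Longrightarrow> \<exists>u\<in>U. p i = u \<otimes> monomial G J q (M i)"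
    and N: "\<And>j. j \<in> J \<Longrightarrow> \<exists>u\<in>U. q j = u \<otimes> monomial G I p (N j)"
    and ik: "i \<in> I" "k \<in> I"
  shows "(\<Sum>j\<in>J. M i j * N j k) = (if i = k then 1 else 0)"
proof -
  note Uc = subgroup.mem_carrier[OF U]
  obtain u where u: "u \<in> U" "p i = u \<otimes> monomial G J q (M i)"
    using M ik by blast
  obtain v where v: "\<And>j. j \<in> J \<Longrightarrow> v j \<in> U \<and> q j = v j \<otimes> monomial G I p (N j)"
    using N by metis
  let ?s = "\<lambda>k. \<Sum>j\<in>J. M i j * N j k"
  let ?w = "finprod G (\<lambda>j. v j [^] M i j) J"
  have w: "?w \<in> U"
    using v by (intro finprod_subgroup_closed[OF U]) (auto intro: int_pow_subgroup_closed[OF U])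
  \<comment> \<open>substitute for each \<open>q j\<close> and collect the units\<close>
  have "monomial G J q (M i)
      = finprod G (\<lambda>j. v j [^] M i j \<otimes> monomial G I p (\<lambda>k. M i j * N j k)) J"
    unfolding monomial_def[of G J]
  proof (intro finprod_cong')
    fix j assume j: "j \<in> J"
    have "q j [^] M i j = (v j \<otimes> monomial G I p (N j)) [^] M i j"
      using v[OF j] by simp
    also have "\<dots> = v j [^] M i j \<otimes> monomial G I p (N j) [^] M i j"
      using v[OF j] p Uc by (intro int_pow_distrib) auto
    finally show "q j [^] M i j = v j [^] M i j \<otimes> monomial G I p (\<lambda>k. M i j * N j k)"
      using monomial_scale[OF p] by simp
  qed (use v Uc p in auto)
  also have "\<dots> = ?w \<otimes> finprod G (\<lambda>j. monomial G I p (\<lambda>k. M i j * N j k)) J"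
    using v Uc p by (intro finprod_multf) auto
  also have "finprod G (\<lambda>j. monomial G I p (\<lambda>k. M i j * N j k)) J = monomial G I p ?s"
    using monomial_sum[OF fin(2) p] by simp
  finally have "p i = (u \<otimes> ?w) \<otimes> monomial G I p ?s"
    using u w Uc p by (simp add: m_assoc)
  then have "monomial G I p (\<lambda>l. (if l = i then 1 else 0) - ?s l) = u \<otimes> ?w"
    using monomial_diff[OF p] monomial_unit_vector[OF fin(1) ik(1) p] u w Uc p
    by (simp add: m_assoc)
  also have "u \<otimes> ?w \<in> U"
    using u w subgroup.m_closed[OF U] by blast
  finally have "(if k = i then 1 else 0) - ?s k = 0"
    using indep ik(2) unfolding independent_modulo_def by blast
  then show ?thesis by auto
qed

end

text \<open>
  The matrices are a priori rectangular. They are square because \<open>M N\<close> and \<open>N M\<close> have the same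
  trace, which is \<open>m\<close> for the one and \<open>n\<close> for the other.
\<close>
lemma mutually_inverse_imp_invertible_mat:
  fixes M N :: "nat \<Rightarrow> nat \<Rightarrow> int"
  assumes MN: "\<And>i k. i < m \<Longrightarrow> k < m \<Longrightarrow> (\<Sum>j<n. M i j * N j k) = (if i = k then 1 else 0)"
    and NM: "\<And>j l. j < n \<Longrightarrow> l < n \<Longrightarrow> (\<Sum>i<m. N j i * M i l) = (if j = l then 1 else 0)"
  shows "m = n" and "invertible_mat (Matrix.mat m n (\<lambda>(i, j). M i j))"
proof -
  have "int m = (\<Sum>i<m. \<Sum>j<n. M i j * N j i)" using MN by simp
  also have "\<dots> = (\<Sum>j<n. \<Sum>i<m. N j i * M i j)"
    by (subst sum.swap) (simp add: mult.commute)
  also have "\<dots> = int n" using NM by simp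
  finally show "m = n" by simp
  have "inverts_mat (Matrix.mat m n (\<lambda>(i, j). M i j)) (Matrix.mat n m (\<lambda>(i, j). N i j))"
    unfolding inverts_mat_def
    by (intro eq_matI) (auto simp: scalar_prod_def MN lessThan_atLeast0[symmetric])
  moreover have "inverts_mat (Matrix.mat n m (\<lambda>(i, j). N i j)) (Matrix.mat m n (\<lambda>(i, j). M i j))"
    unfolding inverts_mat_def
    by (intro eq_matI) (auto simp: scalar_prod_def NM lessThan_atLeast0[symmetric])
  ultimately show "invertible_mat (Matrix.mat m n (\<lambda>(i, j). M i j))"
    using \<open>m = n\<close> unfolding invertible_mat_def by auto
qed

section \<open>Prime factorizations supported on the prime divisors of one element\<close>

text \<open>
  A system of representatives, up to associates, of the prime divisors of \<open>f\<close>. Being stated for a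
  monoid, it applies to the multiplicative monoid of a domain, where \<open>0\<close> cannot count as a prime.
\<close>
definition prime_divisor_system ::
  "('a, 'b) monoid_scheme \<Rightarrow> 'a \<Rightarrow> 'i set \<Rightarrow> ('i \<Rightarrow> 'a) \<Rightarrow> bool" where
  "prime_divisor_system G f I p \<longleftrightarrow>
     p \<in> I \<rightarrow> carrier G \<and>
     (\<forall>i\<in>I. prime G (p i) \<and> p i divides\<^bsub>G\<^esub> f) \<and>
     (\<forall>i\<in>I. \<forall>j\<in>I. p i \<sim>\<^bsub>G\<^esub> p j \<longrightarrow> i = j) \<and>
     (\<forall>q\<in>carrier G. prime G q \<and> q divides\<^bsub>G\<^esub> f \<longrightarrow> (\<exists>i\<in>I. q \<sim>\<^bsub>G\<^esub> p i))"

context comm_monoid_cancel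
begin

lemma prime_divides_nat_pow:
  assumes "prime G q" "q \<in> carrier G" "f \<in> carrier G" "q divides f [^] (k::nat)"
  shows "q divides f"
  using assms(4)
proof (induction k)
  case 0
  then have "q \<in> Units G"
    using assms(2) divides_unit[of q \<one>] by simp
  then show ?case using assms(1) by (auto elim: primeE)
next
  case (Suc k)
  then show ?case
    using prime_divides[of "f [^] k" f q] assms by auto
qed

lemma prime_divides_finprod:
  assumes "prime G q" "q \<in> carrier G" "g \<in> J \<rightarrow> carrier G" "q divides finprod G g J"
  shows "\<exists>j\<in>J. q divides g j"
proof -
  have not_one: "\<not> q divides \<one>"
    using assms(1,2) divides_unit[of q \<one>] by (auto elim: primeE)
  show ?thesis
    using assms(3,4)
  proof (induction J rule: infinite_finite_induct)
    case (insert j J)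
    then have "q divides g j \<otimes> finprod G g J"
      by (subst (asm) finprod_insert) auto
    then have "q divides g j \<or> q divides finprod G g J"
      using insert.prems assms(1) by (intro prime_divides) auto
    then show ?case using insert by auto
  qed (use not_one in auto)
qed

text \<open>
  The power of \<open>p i\<close> on the left divides a product in which the remaining factors are prime to
  \<open>p i\<close>, so it divides the power of \<open>p i\<close> on the right. Applied in both directions this yields that
  the exponents of a product are determined by its class up to units.
\<close>
lemma prime_system_exponents_le:
  assumes "finite I" and p: "p \<in> I \<rightarrow> carrier G" "\<And>i. i \<in> I \<Longrightarrow> prime G (p i)"
    and distinct: "\<And>i j. i \<in> I \<Longrightarrow> j \<in> I \<Longrightarrow> p i \<sim> p j \<Longrightarrow> i = j"
    and dvd: "finprod G (\<lambda>i. p i [^] c i) I divides finprod G (\<lambda>i. p i [^] (d i :: nat)) I"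
    and i: "i \<in> I"
  shows "c i \<le> (d i :: nat)"
proof -
  have split: "finprod G (\<lambda>i. p i [^] e i) I
      = p i [^] e i \<otimes> finprod G (\<lambda>i. p i [^] e i) (I - {i})" for e :: "'c \<Rightarrow> nat"
  proof -
    have "insert i (I - {i}) = I" using i by auto
    then show ?thesis
      using assms(1) p i
        finprod_insert[of "I - {i}" i "\<lambda>i. p i [^] e i"] by (auto simp: Pi_iff)
  qed
  have pi: "p i \<in> carrier G" using p i by auto
  let ?r = "\<lambda>e :: 'c \<Rightarrow> nat. finprod G (\<lambda>i. p i [^] e i) (I - {i})"
  have r: "?r e \<in> carrier G" for e using p by (intro finprod_closed) auto
  have coprime: "\<not> p i divides ?r d"
  proof
    assume "p i divides ?r d"
    then obtain j where j: "j \<in> I - {i}" "p i divides p j [^] d j"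
      using prime_divides_finprod[of "p i" "\<lambda>i. p i [^] d i" "I - {i}"] p i by auto
    then have "p i divides p j"
      using prime_divides_nat_pow p i by blast
    moreover have "p i \<notin> Units G" "irreducible G (p j)"
      using p i j prime_irreducible by (auto elim: primeE)
    ultimately have "p i \<sim> p j"
      using pi unfolding irreducible_def properfactor_def associated_def by blast
    then show False using distinct i j by blast
  qed
  have "p i [^] c i divides ?r d \<otimes> p i [^] d i"
    using dvd pi r divides_trans[of "p i [^] c i" "p i [^] c i \<otimes> ?r c"]
    unfolding split by (auto simp: m_comm)
  then have le: "p i [^] c i divides p i [^] d i"
    using prime_pow_divides_iff[of "p i" "?r d" "p i [^] d i" "c i"] coprime p i r pi by blast
  show ?thesis
  proof (rule ccontr)
    assume "\<not> c i \<le> d i"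
    then have "c i = d i + Suc (c i - d i - 1)" by simp
    then have "p i [^] c i = p i [^] d i \<otimes> p i [^] Suc (c i - d i - 1)"
      using pi nat_pow_mult by metis
    then have "p i [^] d i \<otimes> p i [^] Suc (c i - d i - 1) divides p i [^] d i \<otimes> \<one>"
      using le pi by simp
    then have "p i [^] Suc (c i - d i - 1) divides \<one>"
      using pi divides_mult_l by blast
    then have "p i divides \<one>"
      using pi by (metis divides_prod_l divides_refl divides_trans nat_pow_Suc nat_pow_closed one_closed)
    then show False
      using p i pi divides_unit[of "p i" \<one>] by (auto elim: primeE)
  qed
qed

lemma finprod_fun_upd_pow:
  assumes "finite I" "p \<in> I \<rightarrow> carrier G" "i \<in> I"
  shows "finprod G (\<lambda>j. p j [^] (c(i := Suc (c i))) j) I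
       = p i \<otimes> finprod G (\<lambda>j. p j [^] c j) I"
proof -
  have I: "insert i (I - {i}) = I" using assms(3) by auto
  have pi: "p i \<in> carrier G" using assms by auto
  have "finprod G (\<lambda>j. p j [^] (c(i := Suc (c i))) j) (insert i (I - {i}))
      = p i [^] Suc (c i) \<otimes> finprod G (\<lambda>j. p j [^] (c(i := Suc (c i))) j) (I - {i})"
    using assms by (subst finprod_insert) (auto simp: Pi_iff)
  also have "finprod G (\<lambda>j. p j [^] (c(i := Suc (c i))) j) (I - {i})
      = finprod G (\<lambda>j. p j [^] c j) (I - {i})"
    using assms by (intro finprod_cong') auto
  also have "p i [^] Suc (c i) \<otimes> \<dots>
      = p i \<otimes> (p i [^] c i \<otimes> finprod G (\<lambda>j. p j [^] c j) (I - {i}))"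
  proof -
    have "finprod G (\<lambda>j. p j [^] c j) (I - {i}) \<in> carrier G"
      using assms by (intro finprod_closed) auto
    then show ?thesis using pi by (simp add: m_ac)
  qed
  also have "p i [^] c i \<otimes> finprod G (\<lambda>j. p j [^] c j) (I - {i})
      = finprod G (\<lambda>j. p j [^] c j) (insert i (I - {i}))"
    using assms by (subst finprod_insert) (auto simp: Pi_iff)
  finally show ?thesis unfolding I .
qed

end

context factorial_monoid
begin

text \<open>
  A prime factor of \<open>x\<close> divides a power of \<open>f\<close>, hence \<open>f\<close> itself, and is therefore associated to some
  \<open>p i\<close>. Replacing every factor by its representative leaves only a unit to correct.
\<close>
lemma factorization_in_prime_divisor_system:
  assumes "finite I" and sys: "prime_divisor_system G f I p" and f: "f \<in> carrier G"
    and x: "x \<in> carrier G" "x divides f [^] (k::nat)"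
  shows "\<exists>u\<in>Units G. \<exists>c. x = u \<otimes> finprod G (\<lambda>i. p i [^] (c i :: nat)) I"
proof -
  have p: "p \<in> I \<rightarrow> carrier G"
    using sys unfolding prime_divisor_system_def by blast
  obtain fs where fs: "set fs \<subseteq> carrier G" "wfactors G fs x"
    using wfactors_exist x(1) by blast
  have assoc: "foldr (\<otimes>) fs \<one> \<sim> x" and irr: "\<forall>a\<in>set fs. irreducible G a"
    using fs unfolding wfactors_def by auto
  have factor: "\<exists>i\<in>I. a \<sim> p i" if a: "a \<in> set fs" for a
  proof -
    have "a \<in> carrier G" "prime G a" using a fs irr irreducible_prime by auto
    moreover have "a divides f [^] k"
    proof -
      have "a divides foldr (\<otimes>) fs \<one>"
        using multlist_dividesI a fs by blast
      also have "\<dots> \<sim> x" by (rule assoc)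
      also note x(2)
      finally show ?thesis using a fs x f by auto
    qed
    ultimately have "a \<in> carrier G" "prime G a" "a divides f"
      using prime_divides_nat_pow[of a f k] f by auto
    then show ?thesis
      using sys unfolding prime_divisor_system_def by simp
  qed
  have closed: "finprod G (\<lambda>i. p i [^] (c i :: nat)) I \<in> carrier G" for c
    using p by (intro finprod_closed) auto
  have "\<exists>u\<in>Units G. \<exists>c. foldr (\<otimes>) fs \<one> = u \<otimes> finprod G (\<lambda>i. p i [^] (c i :: nat)) I"
    using fs(1) factor
  proof (induction fs)
    case Nil
    have "\<one> = \<one> \<otimes> finprod G (\<lambda>i. p i [^] (0 :: nat)) I" by simp
    then show ?case by (intro bexI[of _ \<one>] exI[of _ "\<lambda>_. 0"]) auto
  next
    case (Cons a fs)
    then obtain u c where u: "u \<in> Units G"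
      "foldr (\<otimes>) fs \<one> = u \<otimes> finprod G (\<lambda>i. p i [^] (c i :: nat)) I" by auto
    obtain i where i: "i \<in> I" "a \<sim> p i" using Cons.prems by auto
    then obtain v where v: "v \<in> Units G" "a = p i \<otimes> v"
      using associated_iff[of a "p i"] Cons.prems p by auto
    have pi: "p i \<in> carrier G" using i p by auto
    have "foldr (\<otimes>) (a # fs) \<one> = (u \<otimes> v) \<otimes> (p i \<otimes> finprod G (\<lambda>i. p i [^] c i) I)"
      using u v Units_closed[OF u(1)] Units_closed[OF v(1)] pi closed[of c] by (simp add: m_ac)
    also have "p i \<otimes> finprod G (\<lambda>i. p i [^] c i) I
        = finprod G (\<lambda>j. p j [^] (c(i := Suc (c i))) j) I"
      using finprod_fun_upd_pow[OF assms(1) p i(1)] by simp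
    finally show ?case using u v by blast
  qed
  then obtain u c where u: "u \<in> Units G"
    "foldr (\<otimes>) fs \<one> = u \<otimes> finprod G (\<lambda>i. p i [^] (c i :: nat)) I" by auto
  obtain v where v: "v \<in> Units G" "x = foldr (\<otimes>) fs \<one> \<otimes> v"
    using assoc associated_iff[of x "foldr (\<otimes>) fs \<one>"] x fs by (auto simp: associated_sym)
  have "x = (u \<otimes> v) \<otimes> finprod G (\<lambda>i. p i [^] c i) I"
    using u v Units_closed[OF u(1)] Units_closed[OF v(1)] closed[of c] by (simp add: m_ac)
  then show ?thesis using u v by blast
qed

end

section \<open>Irreducible components of a hypersurface in the spectrum of a factorial domain\<close>

lemma openin_zariski:
  "openin (zariski R) U \<longleftrightarrow> (\<exists>S \<subseteq> carrier R. U = {P \<in> spec R. \<not> S \<subseteq> P})"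
  unfolding zariski_def by (subst topology_inverse'[OF istopology_zariski]) (rule refl)

lemma topspace_zariski: "topspace (zariski R) = spec R"
proof
  show "topspace (zariski R) \<subseteq> spec R"
    unfolding topspace_def openin_zariski by blast
  have "{P \<in> spec R. \<not> carrier R \<subseteq> P} = spec R"
    by (auto simp: spec_def dest: primeideal.I_notcarr ideal.Icarr[OF primeideal.axioms(1)])
  then have "openin (zariski R) (spec R)"
    unfolding openin_zariski by blast
  then show "spec R \<subseteq> topspace (zariski R)"
    by (rule openin_subset)
qed

lemma closedin_zariski_specialization:
  assumes "closedin (zariski R) C" "P \<in> C" "P \<subseteq> Q" "Q \<in> spec R"
  shows "Q \<in> C"
proof -
  have "openin (zariski R) (spec R - C)"
    using assms(1) by (simp add: closedin_def topspace_zariski)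
  then obtain S where "spec R - C = {P \<in> spec R. \<not> S \<subseteq> P}"
    unfolding openin_zariski by blast
  moreover have "P \<in> spec R"
    using assms closedin_subset topspace_zariski by blast
  ultimately show ?thesis using assms(2-4) by blast
qed

lemma closedin_zero_locus:
  assumes "a \<in> carrier R"
  shows "closedin (zariski R) (zero_locus R a)"
proof -
  have "spec R - zero_locus R a = {P \<in> spec R. \<not> {a} \<subseteq> P}"
    by (auto simp: zero_locus_def)
  then have "openin (zariski R) (spec R - zero_locus R a)"
    unfolding openin_zariski using assms by blast
  then show ?thesis
    by (auto simp: closedin_def topspace_zariski zero_locus_def)
qed

text \<open>
  A set of primes with a least element \<open>P\<close> is irreducible, since \<open>P\<close> is a generic point: a closed set
  that contains it contains all of the larger primes.
\<close>
lemma irreducible_subspace_of_generic_point: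
  assumes "Z \<subseteq> spec R" "P \<in> Z" "\<And>Q. Q \<in> Z \<Longrightarrow> P \<subseteq> Q"
  shows "irreducible_subspace (zariski R) Z"
  unfolding irreducible_subspace_def
proof (intro conjI allI impI)
  fix C C'
  assume *: "closedin (subtopology (zariski R) Z) C \<and> closedin (subtopology (zariski R) Z) C' \<and> C \<union> C' = Z"
  have whole: "K = Z" if "closedin (subtopology (zariski R) Z) K" "P \<in> K" for K
    using that assms closedin_zariski_specialization[of R _ P]
    unfolding closedin_subtopology by blast
  show "C = Z \<or> C' = Z"
    using * assms(2) whole by blast
qed (use assms in \<open>auto simp: topspace_zariski\<close>)

text \<open>
  An irreducible set need not be closed itself; what matters is that \<open>K\<close> and \<open>L\<close> cut out closed
  subsets of it that cover it.
\<close>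
lemma irreducible_subspace_in_closed_union:
  assumes "irreducible_subspace T Z" "Z \<subseteq> K \<union> L" "closedin T K" "closedin T L"
  shows "Z \<subseteq> K \<or> Z \<subseteq> L"
proof -
  have "(K \<inter> Z) \<union> (L \<inter> Z) = Z" using assms(2) by blast
  moreover have "closedin (subtopology T Z) (K \<inter> Z)" "closedin (subtopology T Z) (L \<inter> Z)"
    using assms(3,4) by (auto simp: closedin_subtopology)
  ultimately have "K \<inter> Z = Z \<or> L \<inter> Z = Z"
    using assms(1) unfolding irreducible_subspace_def by blast
  then show ?thesis by blast
qed

context cring
begin

lemma zero_locus_mult:
  assumes "a \<in> carrier R" "b \<in> carrier R"
  shows "zero_locus R (a \<otimes> b) = zero_locus R a \<union> zero_locus R b"
  using assms primeideal.I_prime[of _ R a b]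
    ideal.I_l_closed[OF primeideal.axioms(1), of _ R b a]
    ideal.I_r_closed[OF primeideal.axioms(1), of _ R a b]
  unfolding zero_locus_def spec_def by blast

lemma zero_locus_mono:
  assumes "a \<in> carrier R" "b \<in> carrier R" "a divides b"
  shows "zero_locus R a \<subseteq> zero_locus R b"
proof -
  obtain c where "c \<in> carrier R" "b = a \<otimes> c" using assms(3) by auto
  then show ?thesis using zero_locus_mult[of a c] assms(1) by auto
qed

lemma zero_locus_unit: "u \<in> Units R \<Longrightarrow> zero_locus R u = {}"
proof -
  assume u: "u \<in> Units R"
  { fix P assume P: "primeideal P R" "u \<in> P"
    interpret primeideal P R by (rule P(1))
    have "\<one> \<in> P" using u P(2) I_l_closed[of u "inv u"] by simp
    then have False using one_imp_carrier I_notcarr by auto }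
  then show "zero_locus R u = {}" unfolding zero_locus_def spec_def by blast
qed

end

context domain
begin

text \<open>
  This makes the principal ideal of \<open>p\<close> the generic point of the zero locus of \<open>p\<close>.
\<close>
lemma prime_spec:
  assumes "p \<in> carrier (mult_of R)" "prime (mult_of R) p"
  shows "PIdl p \<in> spec R" "PIdl p \<in> zero_locus R p"
    and "\<And>Q. Q \<in> zero_locus R p \<Longrightarrow> PIdl p \<subseteq> Q"
proof -
  have p: "p \<in> carrier R" "ring_prime p" using assms ring_primeI' by auto
  show s: "PIdl p \<in> spec R"
    using primeideal_iff_prime assms p unfolding spec_def by auto
  then show "PIdl p \<in> zero_locus R p"
    using cgenideal_self p unfolding zero_locus_def by blast
  show "PIdl p \<subseteq> Q" if "Q \<in> zero_locus R p" for Q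
    using that cgenideal_minimal primeideal.axioms(1) unfolding zero_locus_def spec_def by blast
qed

lemma vanishing_ideal_zero_locus_prime:
  assumes "p \<in> carrier (mult_of R)" "prime (mult_of R) p"
  shows "vanishing_ideal R (zero_locus R p) = PIdl p"
proof
  show "vanishing_ideal R (zero_locus R p) \<subseteq> PIdl p"
    using prime_spec(2)[OF assms] unfolding vanishing_ideal_def by blast
  have "ideal (PIdl p) R"
    using assms(1) by (intro cgenideal_ideal) auto
  then have "x \<in> vanishing_ideal R (zero_locus R p)" if "x \<in> PIdl p" for x
    using prime_spec(3)[OF assms] that ideal.Icarr[of "PIdl p" R x]
    unfolding vanishing_ideal_def by auto
  then show "PIdl p \<subseteq> vanishing_ideal R (zero_locus R p)" by blast
qed

lemma zero_locus_prime_subset_iff: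
  assumes "p \<in> carrier (mult_of R)" "prime (mult_of R) p" "q \<in> carrier (mult_of R)"
  shows "zero_locus R p \<subseteq> zero_locus R q \<longleftrightarrow> p divides\<^bsub>mult_of R\<^esub> q"
proof
  assume "zero_locus R p \<subseteq> zero_locus R q"
  then have "q \<in> PIdl p" using prime_spec(2)[OF assms(1,2)] unfolding zero_locus_def by blast
  then obtain c where c: "c \<in> carrier R" "q = c \<otimes> p" unfolding cgenideal_def by blast
  then have "p divides q" using assms(1) by (auto simp: factor_def m_comm)
  then show "p divides\<^bsub>mult_of R\<^esub> q" using assms by auto
next
  assume "p divides\<^bsub>mult_of R\<^esub> q"
  then show "zero_locus R p \<subseteq> zero_locus R q"
    using zero_locus_mono[of p q] assms by auto
qed

lemma prime_divides_prime_imp_associated: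
  assumes "p \<in> carrier (mult_of R)" "prime (mult_of R) p"
    and "q \<in> carrier (mult_of R)" "prime (mult_of R) q" "p divides\<^bsub>mult_of R\<^esub> q"
  shows "p \<sim>\<^bsub>mult_of R\<^esub> q"
proof -
  have "p \<notin> Units (mult_of R)" using assms(2) unfolding prime_def by simp
  moreover have "irreducible (mult_of R) q" using assms(4) by (rule mult_of.prime_irreducible)
  ultimately show ?thesis
    using assms unfolding irreducible_def properfactor_def associated_def by blast
qed

end

context factorial_domain
begin

text \<open>
  If \<open>f\<close> is a product of primes, its zero locus is the finite union of their closed zero loci,
  and an irreducible set covered by finitely many closed sets lies in one of them.
\<close>
lemma irreducible_subspace_zero_locus:
  assumes "irreducible_subspace (zariski R) Z" "f \<in> carrier (mult_of R)" "Z \<subseteq> zero_locus R f"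
  shows "\<exists>p\<in>carrier (mult_of R). prime (mult_of R) p \<and> p divides\<^bsub>mult_of R\<^esub> f
           \<and> Z \<subseteq> zero_locus R p"
proof -
  have ne: "Z \<noteq> {}" using assms(1) unfolding irreducible_subspace_def by blast
  then have "f \<notin> Units (mult_of R)" using zero_locus_unit assms(3) by auto
  then obtain fs where fs: "set fs \<subseteq> carrier (mult_of R)" "factors (mult_of R) fs f"
    using factors_exist assms(2) by blast
  have closed: "foldr (\<otimes>) gs \<one> \<in> carrier R" if "set gs \<subseteq> carrier R" for gs
    using that by (induction gs) auto
  have split: "\<exists>a\<in>set gs. Z \<subseteq> zero_locus R a"
    if "set gs \<subseteq> carrier R" "Z \<subseteq> zero_locus R (foldr (\<otimes>) gs \<one>)" for gs
    using that
  proof (induction gs)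
    case Nil
    then show ?case using ne zero_locus_unit[of \<one>] by auto
  next
    case (Cons a gs)
    then have "Z \<subseteq> zero_locus R a \<union> zero_locus R (foldr (\<otimes>) gs \<one>)"
      using zero_locus_mult[of a "foldr (\<otimes>) gs \<one>"] closed[of gs] by auto
    then have "Z \<subseteq> zero_locus R a \<or> Z \<subseteq> zero_locus R (foldr (\<otimes>) gs \<one>)"
      using closed[of gs] Cons.prems
      by (intro irreducible_subspace_in_closed_union[OF assms(1)] closedin_zero_locus) auto
    then show ?case using Cons by auto
  qed
  have f: "foldr (\<otimes>) fs \<one> = f" "\<forall>a\<in>set fs. irreducible (mult_of R) a"
    using fs unfolding factors_def by auto
  obtain a where a: "a \<in> set fs" "Z \<subseteq> zero_locus R a"
    using split[of fs] assms(3) fs(1) f(1) by auto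
  moreover have "a \<in> carrier (mult_of R)" using a fs by blast
  moreover have "prime (mult_of R) a"
    using a f fs irreducible_prime by auto
  moreover have "a divides\<^bsub>mult_of R\<^esub> f"
    using mult_of.factors_dividesI[OF fs(2) a(1) fs(1)] .
  ultimately show ?thesis by blast
qed

text \<open>
  The zero loci of the prime divisors are irreducible, each having a generic point, and every
  irreducible subset of the zero locus of \<open>f\<close> lies in one of them. No inclusion between two of them
  is proper, because a prime dividing another prime is associated to it; hence they are exactly
  the maximal irreducible subsets.
\<close>
lemma irreducible_components_zero_locus:
  assumes f: "f \<in> carrier (mult_of R)"
  shows "irreducible_components (zariski R) (zero_locus R f)
       = zero_locus R ` {p \<in> carrier (mult_of R). prime (mult_of R) p \<and> p divides\<^bsub>mult_of R\<^esub> f}"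
    (is "?L = zero_locus R ` ?P")
proof -
  have irr: "irreducible_subspace (zariski R) (zero_locus R p)"
    and sub: "zero_locus R p \<subseteq> zero_locus R f" if "p \<in> ?P" for p
  proof -
    show "irreducible_subspace (zariski R) (zero_locus R p)"
      using that prime_spec[of p] irreducible_subspace_of_generic_point[of "zero_locus R p" R "PIdl p"]
      unfolding zero_locus_def by auto
    show "zero_locus R p \<subseteq> zero_locus R f"
      using that f zero_locus_prime_subset_iff by blast
  qed
  have eq: "W = zero_locus R p"
    if p: "p \<in> ?P" and W: "irreducible_subspace (zariski R) W" "zero_locus R p \<subseteq> W"
      "W \<subseteq> zero_locus R f" for W p
  proof -
    obtain q where q: "q \<in> ?P" "W \<subseteq> zero_locus R q"
      using irreducible_subspace_zero_locus[OF W(1) f W(3)] by blast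
    then have "p divides\<^bsub>mult_of R\<^esub> q"
      using p W(2) zero_locus_prime_subset_iff by blast
    then have "q divides\<^bsub>mult_of R\<^esub> p"
      using p q prime_divides_prime_imp_associated unfolding associated_def by blast
    then have "zero_locus R q \<subseteq> zero_locus R p"
      using p q zero_locus_prime_subset_iff by blast
    then show ?thesis using q W by blast
  qed
  show ?thesis
  proof
    show "?L \<subseteq> zero_locus R ` ?P"
    proof
      fix Z assume "Z \<in> ?L"
      then have Z: "irreducible_subspace (zariski R) Z" "Z \<subseteq> zero_locus R f"
        "\<And>W. irreducible_subspace (zariski R) W \<Longrightarrow> Z \<subseteq> W \<Longrightarrow> W \<subseteq> zero_locus R f \<Longrightarrow> W = Z"
        unfolding irreducible_components_def by auto
      obtain p where "p \<in> ?P" "Z \<subseteq> zero_locus R p"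
        using irreducible_subspace_zero_locus[OF Z(1) f Z(2)] by blast
      then show "Z \<in> zero_locus R ` ?P" using Z(3)[of "zero_locus R p"] irr sub by blast
    qed
    show "zero_locus R ` ?P \<subseteq> ?L"
      using irr sub eq unfolding irreducible_components_def by blast
  qed
qed

text \<open>
  Consequently an enumeration of the components amounts to one of the prime divisors of \<open>f\<close> up to
  associates, and each component is the divisor of a single prime element.
\<close>
lemma prime_equations_of_components:
  assumes f: "f \<in> carrier (mult_of R)"
    and D: "bij_betw D {..<n :: nat} (irreducible_components (zariski R) (zero_locus R f))"
  obtains p where "prime_divisor_system (mult_of R) f {..<n} p"
    and "\<And>i. i < n \<Longrightarrow> vanishing_ideal R (D i) = PIdl (p i)"
proof -
  let ?P = "{p \<in> carrier (mult_of R). prime (mult_of R) p \<and> p divides\<^bsub>mult_of R\<^esub> f}"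
  have D_image: "D ` {..<n} = zero_locus R ` ?P" and inj: "inj_on D {..<n}"
    using D irreducible_components_zero_locus[OF f] by (auto simp: bij_betw_def)
  then have "\<forall>i\<in>{..<n}. \<exists>p. p \<in> ?P \<and> D i = zero_locus R p" by blast
  then obtain p where p: "\<And>i. i < n \<Longrightarrow> p i \<in> ?P \<and> D i = zero_locus R (p i)"
    by (metis lessThan_iff)
  have "prime_divisor_system (mult_of R) f {..<n} p"
    unfolding prime_divisor_system_def
  proof (intro conjI ballI impI)
    fix i j assume ij: "i \<in> {..<n}" "j \<in> {..<n}" "p i \<sim>\<^bsub>mult_of R\<^esub> p j"
    then have "D i = D j"
      using p[of i] p[of j] zero_locus_prime_subset_iff[of "p i" "p j"]
        zero_locus_prime_subset_iff[of "p j" "p i"]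
      unfolding associated_def by blast
    then show "i = j" using inj ij unfolding inj_on_def by blast
  next
    fix q assume q: "q \<in> carrier (mult_of R)" "prime (mult_of R) q \<and> q divides\<^bsub>mult_of R\<^esub> f"
    then have "zero_locus R q \<in> D ` {..<n}" using D_image by blast
    then obtain i where i: "i < n" "zero_locus R q = zero_locus R (p i)" using p by auto
    then have "q divides\<^bsub>mult_of R\<^esub> p i"
      using p[of i] q zero_locus_prime_subset_iff[of q "p i"] by blast
    then have "q \<sim>\<^bsub>mult_of R\<^esub> p i"
      using p[of i] i q by (intro prime_divides_prime_imp_associated) auto
    then show "\<exists>i\<in>{..<n}. q \<sim>\<^bsub>mult_of R\<^esub> p i" using i by blast
  qed (use p in auto)
  moreover have "vanishing_ideal R (D i) = PIdl (p i)" if "i < n" for i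
    using p[OF that] vanishing_ideal_zero_locus_prime by auto
  ultimately show ?thesis using that by blast
qed

end

section \<open>Divisor ideals and the multiplicity matrix\<close>

text \<open>
  The same product of elements is formed in a domain, in its multiplicative monoid, in a larger
  domain and in the multiplicative group of the fraction field. This lemma passes between these.
\<close>
lemma finprod_eq_in_common_submonoid:
  assumes G: "comm_monoid G" and H: "comm_monoid H"
    and same: "monoid.mult G = monoid.mult H" "monoid.one G = monoid.one H"
    and g: "g \<in> J \<rightarrow> carrier G" "g \<in> J \<rightarrow> carrier H"
  shows "finprod G g J = finprod H g J"
  using g
proof (induction J rule: infinite_finite_induct)
  case (insert j J)
  then show ?case
    using comm_monoid.finprod_insert[OF G, of J j g] comm_monoid.finprod_insert[OF H, of J j g] same
    by auto
qed (use same comm_monoid.finprod_empty comm_monoid.finprod_infinite G H in metis)+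

context cring
begin

lemma ideal_prod_principal:
  assumes "a \<in> carrier R" "b \<in> carrier R"
  shows "ideal_prod R (PIdl a) (PIdl b) = PIdl (a \<otimes> b)"
proof -
  have J: "ideal (PIdl (a \<otimes> b)) R" using assms by (intro cgenideal_ideal) auto
  then have "PIdl (a \<otimes> b) \<subseteq> carrier R" using ideal.Icarr by fast
  then have "Idl (PIdl (a \<otimes> b)) = PIdl (a \<otimes> b)"
    using genideal_minimal[OF J] genideal_self by blast
  then show ?thesis
    using ideal_prod_eq_genideal[OF cgenideal_ideal cgenideal_ideal] cgenideal_prod assms by simp
qed

lemma principal_ideal_pow:
  assumes "a \<in> carrier R"
  shows "PIdl a [^]\<^bsub>ideals_set R\<^esub> (k::nat) = PIdl (a [^] k)"
proof (induction k)
  case 0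
  have "carrier R = PIdl \<one>" using ideal_eq_carrier_iff[of \<one>] by simp
  then show ?case by (simp add: ideals_set_def)
next
  case (Suc k)
  then show ?case
    using ideal_prod_principal[of "a [^] k" a] assms by (simp add: ideals_set_def)
qed

lemma finprod_principal_ideals:
  assumes "finite J" "g \<in> J \<rightarrow> carrier R"
  shows "finprod (ideals_set R) (\<lambda>j. PIdl (g j)) J = PIdl (finprod R g J)"
  using assms
proof (induction J rule: finite_induct)
  case empty
  have "carrier R = PIdl \<one>" using ideal_eq_carrier_iff[of \<one>] by simp
  then show ?case
    using comm_monoid.finprod_empty[OF ideals_set_is_comm_monoid] by (simp add: ideals_set_def)
next
  case (insert j J)
  have "finprod (ideals_set R) (\<lambda>j. PIdl (g j)) (insert j J)
      = ideal_prod R (PIdl (g j)) (finprod (ideals_set R) (\<lambda>j. PIdl (g j)) J)"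
    using insert cgenideal_ideal
    by (subst comm_monoid.finprod_insert[OF ideals_set_is_comm_monoid]) (auto simp: ideals_set_def)
  also have "\<dots> = PIdl (g j \<otimes> finprod R g J)"
    using insert by (simp add: ideal_prod_principal Pi_iff)
  finally show ?case using insert by (simp add: Pi_iff)
qed

text \<open>
  When the components are cut out by single elements \<open>q j\<close>, a combination of them is cut out by the
  corresponding product of powers, so equality of divisors becomes association of elements.
\<close>
lemma divisor_ideal_principal:
  assumes "\<And>j. j < n \<Longrightarrow> q j \<in> carrier R \<and> vanishing_ideal R (E j) = PIdl (q j)"
  shows "divisor_ideal R n E m = PIdl (finprod R (\<lambda>j. q j [^] m j) {..<n})"
proof -
  have ideals: "ideal (PIdl (q j [^] m j)) R" if "j < n" for j
    using assms[OF that] by (intro cgenideal_ideal) auto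
  have "divisor_ideal R n E m = finprod (ideals_set R) (\<lambda>j. PIdl (q j [^] m j)) {..<n}"
    unfolding divisor_ideal_def
    using assms ideals principal_ideal_pow
    by (intro comm_monoid.finprod_cong'[OF ideals_set_is_comm_monoid]) (auto simp: ideals_set_def)
  also have "\<dots> = PIdl (finprod R (\<lambda>j. q j [^] m j) {..<n})"
    using assms by (intro finprod_principal_ideals) auto
  finally show ?thesis .
qed

end

lemma pullback_principal_ideal:
  assumes R: "cring R" and R': "cring R'" and sub: "carrier R \<subseteq> carrier R'"
    and mult: "monoid.mult R = monoid.mult R'" and p: "p \<in> carrier R"
  shows "pullback_ideal R' (PIdl\<^bsub>R\<^esub> p) = PIdl\<^bsub>R'\<^esub> p"
proof
  interpret R: cring R by fact
  interpret R': cring R' by fact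
  have le: "PIdl\<^bsub>R\<^esub> p \<subseteq> PIdl\<^bsub>R'\<^esub> p"
    using sub mult by (auto simp: cgenideal_def)
  have J: "ideal (PIdl\<^bsub>R'\<^esub> p) R'" using p sub by (intro R'.cgenideal_ideal) auto
  then show "pullback_ideal R' (PIdl\<^bsub>R\<^esub> p) \<subseteq> PIdl\<^bsub>R'\<^esub> p"
    unfolding pullback_ideal_def using le by (intro R'.genideal_minimal)
  have c: "PIdl\<^bsub>R\<^esub> p \<subseteq> carrier R'" using le ideal.Icarr[OF J] by blast
  have "p \<in> Idl\<^bsub>R'\<^esub> (PIdl\<^bsub>R\<^esub> p)"
    using R'.genideal_self[OF c] R.cgenideal_self[OF p] by blast
  then show "PIdl\<^bsub>R'\<^esub> p \<subseteq> pullback_ideal R' (PIdl\<^bsub>R\<^esub> p)"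
    unfolding pullback_ideal_def by (intro R'.cgenideal_minimal R'.genideal_ideal c)
qed

text \<open>
  In terms of the equations \<open>p i\<close> and \<open>q j\<close>, the relation defining row \<open>i\<close> of the matrix says that
  \<open>p i\<close> and the product of the \<open>q j\<close> with these exponents are associated. A factorization of \<open>p i\<close>
  thus provides such a row, and uniqueness of exponents shows that there is no other, so the
  definite description picks out the matrix of exponents.
\<close>
lemma multiplicity_matrix_eqI:
  fixes R :: "('a, 'b) ring_scheme" and R' :: "('a, 'c) ring_scheme"
  assumes R: "domain R" and R': "domain R'"
    and sub: "carrier R \<subseteq> carrier R'" and mult: "monoid.mult R = monoid.mult R'"
    and D: "\<And>i. i < n \<Longrightarrow> p i \<in> carrier R \<and> vanishing_ideal R (D i) = PIdl\<^bsub>R\<^esub> (p i)"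
    and E: "\<And>j. j < n' \<Longrightarrow> vanishing_ideal R' (E j) = PIdl\<^bsub>R'\<^esub> (q j)"
    and sys: "prime_divisor_system (mult_of R') f {..<n'} q"
    and fact: "\<And>i. i < n \<Longrightarrow> \<exists>u\<in>Units R'.
                 p i = u \<otimes>\<^bsub>R'\<^esub> finprod R' (\<lambda>j. q j [^]\<^bsub>R'\<^esub> (m i j :: nat)) {..<n'}"
  shows "multiplicity_matrix R R' n D n' E = Matrix.mat n n' (\<lambda>(i, j). int (m i j))"
proof -
  interpret R: domain R by fact
  interpret R': domain R' by fact
  have q: "q j \<in> carrier (mult_of R')" "prime (mult_of R') (q j)" if "j < n'" for j
    using sys that unfolding prime_divisor_system_def by auto
  let ?x = "\<lambda>e :: nat \<Rightarrow> nat. finprod R' (\<lambda>j. q j [^]\<^bsub>R'\<^esub> e j) {..<n'}"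
  let ?y = "\<lambda>e :: nat \<Rightarrow> nat. finprod (mult_of R') (\<lambda>j. q j [^]\<^bsub>mult_of R'\<^esub> e j) {..<n'}"
  have qpow: "q j [^]\<^bsub>mult_of R'\<^esub> (e j :: nat) \<in> carrier (mult_of R')" if "j < n'" for j e
    using q[OF that] by (intro R'.mult_of.nat_pow_closed)
  have xy: "?x e = ?y e" for e
  proof -
    have "?x e = finprod R' (\<lambda>j. q j [^]\<^bsub>mult_of R'\<^esub> e j) {..<n'}"
      by (simp add: nat_pow_mult_of)
    also have "\<dots> = ?y e"
      using qpow R'.comm_monoid_axioms R'.mult_of.comm_monoid_axioms
      by (intro finprod_eq_in_common_submonoid) auto
    finally show ?thesis .
  qed
  have y: "?y e \<in> carrier (mult_of R')" for e
    using qpow by (intro R'.mult_of.finprod_closed) auto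
  have row: "pullback_ideal R' (vanishing_ideal R (D i)) = divisor_ideal R' n' E e
      \<longleftrightarrow> (\<forall>j<n'. e j = m i j)" if i: "i < n" for i e
  proof -
    obtain u where u: "u \<in> Units R'" "p i = u \<otimes>\<^bsub>R'\<^esub> ?x (m i)"
      using fact[OF i] by blast
    have x: "?x e \<in> carrier R'" for e using y[of e] xy by simp
    have pi: "p i \<in> carrier R'" using D[OF i] sub by blast
    have "pullback_ideal R' (vanishing_ideal R (D i)) = PIdl\<^bsub>R'\<^esub> (p i)"
      using pullback_principal_ideal[OF R.cring_axioms R'.cring_axioms sub mult] D[OF i] by simp
    also have "p i \<sim>\<^bsub>R'\<^esub> ?x (m i)"
      using R'.ring_associated_iff[OF pi x] u by blast
    then have "PIdl\<^bsub>R'\<^esub> (p i) = PIdl\<^bsub>R'\<^esub> (?x (m i))"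
      using R'.associated_iff_same_ideal[OF pi x] by blast
    finally have pull: "pullback_ideal R' (vanishing_ideal R (D i)) = PIdl\<^bsub>R'\<^esub> (?x (m i))" .
    have div: "divisor_ideal R' n' E e = PIdl\<^bsub>R'\<^esub> (?x e)"
      using E q by (intro R'.divisor_ideal_principal) auto
    show ?thesis
    proof
      assume "pullback_ideal R' (vanishing_ideal R (D i)) = divisor_ideal R' n' E e"
      then have "?x (m i) \<sim>\<^bsub>R'\<^esub> ?x e"
        using pull div R'.associated_iff_same_ideal[OF x x] by simp
      then have a: "?y (m i) \<sim>\<^bsub>mult_of R'\<^esub> ?y e"
        using R'.assoc_iff_assoc_mult[OF x x] xy by simp
      have le: "d j \<le> e' j" if "?y d divides\<^bsub>mult_of R'\<^esub> ?y e'" "j < n'" for d e' j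
        using R'.mult_of.prime_system_exponents_le[of "{..<n'}" q d e' j] that sys
        unfolding prime_divisor_system_def by auto
      show "\<forall>j<n'. e j = m i j"
        using a le[of "m i" e] le[of e "m i"] unfolding associated_def by (simp add: le_antisym)
    next
      assume "\<forall>j<n'. e j = m i j"
      then have "?x e = ?x (m i)"
        using q by (intro R'.finprod_cong') auto
      then show "pullback_ideal R' (vanishing_ideal R (D i)) = divisor_ideal R' n' E e"
        using pull div by simp
    qed
  qed
  have "(THE M. M \<in> carrier_mat n n' \<and>
        (\<forall>i<n. pullback_ideal R' (vanishing_ideal R (D i)) =
               divisor_ideal R' n' E (\<lambda>j. M $$ (i, j)))) = Matrix.mat n n' (\<lambda>(i, j). m i j)"
    by (rule the_equality) (auto simp: row)
  then show ?thesis
    unfolding multiplicity_matrix_def by (auto intro!: eq_matI)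
qed

section \<open>Factorial subrings of a field and the affine modification\<close>

context field
begin

lemma carrier_units_of: "carrier (units_of R) = carrier R - {\<zero>}"
  by (simp add: units_of_carrier field_Units)

lemma units_of_comm_group: "comm_group (units_of R)"
  by (rule units_comm_group)

text \<open>
  The inverse of a unit of \<open>B\<close> is the same in \<open>B\<close> and in the field.
\<close>
lemma subdomain_units_subgroup:
  assumes sub: "B \<subseteq> carrier R" and dom: "domain (R\<lparr>carrier := B\<rparr>)"
  shows "subgroup (Units (R\<lparr>carrier := B\<rparr>)) (units_of R)"
proof -
  interpret B: domain "R\<lparr>carrier := B\<rparr>" by fact
  interpret G: comm_group "units_of R" by (rule units_of_comm_group)
  have unit: "u \<in> Units R" if "u \<in> Units (R\<lparr>carrier := B\<rparr>)" for u
    using that sub unfolding Units_def by auto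
  show ?thesis
  proof (rule G.subgroupI)
    show "Units (R\<lparr>carrier := B\<rparr>) \<subseteq> carrier (units_of R)"
      using unit by (auto simp: units_of_carrier)
    show "Units (R\<lparr>carrier := B\<rparr>) \<noteq> {}"
      using B.Units_one_closed by blast
  next
    fix u assume u: "u \<in> Units (R\<lparr>carrier := B\<rparr>)"
    then obtain v where v: "v \<in> B" "v \<otimes> u = \<one>" "u \<otimes> v = \<one>"
      unfolding Units_def by auto
    then have "v \<in> Units (R\<lparr>carrier := B\<rparr>)"
      using u unfolding Units_def by auto
    moreover from this have "inv\<^bsub>units_of R\<^esub> u = v"
      using v unit u by (intro G.inv_equality) (auto simp: units_of_carrier units_of_mult units_of_one)
    ultimately show "inv\<^bsub>units_of R\<^esub> u \<in> Units (R\<lparr>carrier := B\<rparr>)" by simp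
  next
    fix u v assume "u \<in> Units (R\<lparr>carrier := B\<rparr>)" "v \<in> Units (R\<lparr>carrier := B\<rparr>)"
    then show "u \<otimes>\<^bsub>units_of R\<^esub> v \<in> Units (R\<lparr>carrier := B\<rparr>)"
      using B.Units_m_closed by (simp add: units_of_mult)
  qed
qed

lemma monomial_eq_finprod_subdomain:
  assumes sub: "B \<subseteq> carrier R" and dom: "domain (R\<lparr>carrier := B\<rparr>)"
    and p: "p \<in> I \<rightarrow> B - {\<zero>}"
  shows "monomial (units_of R) I p (\<lambda>i. int (c i))
       = finprod (mult_of (R\<lparr>carrier := B\<rparr>)) (\<lambda>i. p i [^]\<^bsub>mult_of (R\<lparr>carrier := B\<rparr>)\<^esub> c i) I"
    and "finprod (R\<lparr>carrier := B\<rparr>) (\<lambda>i. p i [^]\<^bsub>R\<lparr>carrier := B\<rparr>\<^esub> c i) I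
       = monomial (units_of R) I p (\<lambda>i. int (c i))"
proof -
  interpret B: domain "R\<lparr>carrier := B\<rparr>" by fact
  interpret G: comm_group "units_of R" by (rule units_of_comm_group)
  let ?K = "mult_of (R\<lparr>carrier := B\<rparr>)"
  have pow: "p i [^]\<^bsub>units_of R\<^esub> int (c i) = p i [^]\<^bsub>?K\<^esub> c i" for i
    by (simp add: int_pow_int nat_pow_def units_of_mult units_of_one)
  have K: "p i [^]\<^bsub>?K\<^esub> c i \<in> carrier ?K" if "i \<in> I" for i
    using p that by (intro B.mult_of.nat_pow_closed) auto
  then have Gc: "p i [^]\<^bsub>?K\<^esub> c i \<in> carrier (units_of R)" if "i \<in> I" for i
    using that sub by (auto simp: carrier_units_of)
  show 1: "monomial (units_of R) I p (\<lambda>i. int (c i)) = finprod ?K (\<lambda>i. p i [^]\<^bsub>?K\<^esub> c i) I"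
    unfolding monomial_def pow using K Gc G.comm_monoid_axioms B.mult_of.comm_monoid_axioms
    by (intro finprod_eq_in_common_submonoid) (auto simp: units_of_mult units_of_one)
  have "finprod ?K (\<lambda>i. p i [^]\<^bsub>?K\<^esub> c i) I
      = finprod (R\<lparr>carrier := B\<rparr>) (\<lambda>i. p i [^]\<^bsub>?K\<^esub> c i) I"
    using K B.comm_monoid_axioms B.mult_of.comm_monoid_axioms
    by (intro finprod_eq_in_common_submonoid) auto
  then show "finprod (R\<lparr>carrier := B\<rparr>) (\<lambda>i. p i [^]\<^bsub>R\<lparr>carrier := B\<rparr>\<^esub> c i) I
       = monomial (units_of R) I p (\<lambda>i. int (c i))"
    unfolding 1 by (simp add: nat_pow_mult_of)
qed

text \<open>
  Moving the factors with negative exponents to the other side turns a relation modulo units into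
  an association between two products with natural exponents. Uniqueness of exponents equates the
  positive and the negative part of every \<open>e i\<close>, so both vanish.
\<close>
lemma prime_divisor_system_independent:
  assumes sub: "B \<subseteq> carrier R" and dom: "domain (R\<lparr>carrier := B\<rparr>)" and fin: "finite I"
    and sys: "prime_divisor_system (mult_of (R\<lparr>carrier := B\<rparr>)) f I p"
  shows "independent_modulo (units_of R) (Units (R\<lparr>carrier := B\<rparr>)) I p"
  unfolding independent_modulo_def
proof (intro allI impI ballI)
  fix e i
  assume unit: "monomial (units_of R) I p e \<in> Units (R\<lparr>carrier := B\<rparr>)" and i: "i \<in> I"
  interpret B: domain "R\<lparr>carrier := B\<rparr>" by fact
  interpret G: comm_group "units_of R" by (rule units_of_comm_group)
  let ?K = "mult_of (R\<lparr>carrier := B\<rparr>)"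
  let ?y = "\<lambda>c :: _ \<Rightarrow> nat. finprod ?K (\<lambda>i. p i [^]\<^bsub>?K\<^esub> c i) I"
  have p: "p \<in> I \<rightarrow> B - {\<zero>}" using sys unfolding prime_divisor_system_def by simp
  then have pG: "p \<in> I \<rightarrow> carrier (units_of R)" using sub by (auto simp: carrier_units_of)
  have yK: "?y c \<in> carrier ?K" for c
    using p by (intro B.mult_of.finprod_closed Pi_I B.mult_of.nat_pow_closed) auto
  let ?c = "\<lambda>i. nat (e i)" and ?d = "\<lambda>i. nat (- e i)"
  have "(\<lambda>i. int (?c i)) = (\<lambda>i. e i + int (?d i))" by auto
  then have "?y ?c = monomial (units_of R) I p e \<otimes> ?y ?d"
    using G.monomial_add[OF pG, of e "\<lambda>i. int (?d i)"]
      monomial_eq_finprod_subdomain(1)[OF sub dom p, of ?c]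
      monomial_eq_finprod_subdomain(1)[OF sub dom p, of ?d] by (simp add: units_of_mult)
  then have "\<exists>u\<in>Units (R\<lparr>carrier := B\<rparr>). ?y ?c = u \<otimes>\<^bsub>R\<lparr>carrier := B\<rparr>\<^esub> ?y ?d"
    by (intro bexI[OF _ unit]) simp
  moreover have yB: "?y c \<in> carrier (R\<lparr>carrier := B\<rparr>)" for c
    using yK[of c] by simp
  ultimately have assoc: "?y ?c \<sim>\<^bsub>R\<lparr>carrier := B\<rparr>\<^esub> ?y ?d"
    by (intro iffD2[OF B.ring_associated_iff[OF yB yB]])
  have assocK: "?y ?c \<sim>\<^bsub>?K\<^esub> ?y ?d"
    by (rule iffD1[OF B.assoc_iff_assoc_mult[OF yB yB] assoc])
  have le: "a i \<le> b i" if "?y a divides\<^bsub>?K\<^esub> ?y b" for a b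
    using B.mult_of.prime_system_exponents_le[OF fin, of p a b i] that sys i
    unfolding prime_divisor_system_def by auto
  have "?c i = ?d i"
    using assocK le[of ?c ?d] le[of ?d ?c] unfolding associated_def by (simp add: le_antisym)
  then show "e i = 0" by simp
qed

lemma divisor_of_power_eq_monomial:
  assumes sub: "B \<subseteq> carrier R" and fact: "factorial_domain (R\<lparr>carrier := B\<rparr>)" and fin: "finite I"
    and sys: "prime_divisor_system (mult_of (R\<lparr>carrier := B\<rparr>)) f I p"
    and f: "f \<in> B - {\<zero>}" and x: "x \<in> B" "y \<in> B" "x \<otimes> y = f [^] (k :: nat)"
  shows "\<exists>u\<in>Units (R\<lparr>carrier := B\<rparr>). \<exists>c :: _ \<Rightarrow> nat. x = u \<otimes> monomial (units_of R) I p (\<lambda>i. int (c i))"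
proof -
  interpret B: factorial_domain "R\<lparr>carrier := B\<rparr>" by fact
  let ?K = "mult_of (R\<lparr>carrier := B\<rparr>)"
  have p: "p \<in> I \<rightarrow> B - {\<zero>}" using sys unfolding prime_divisor_system_def by simp
  have pow: "f [^]\<^bsub>?K\<^esub> k = f [^] k" by (simp add: nat_pow_def)
  have "f [^] k \<noteq> \<zero>"
    using B.mult_of.nat_pow_closed[of f k] f pow by simp
  then have "x \<noteq> \<zero>" "y \<noteq> \<zero>" using x sub by auto
  then have "x divides\<^bsub>?K\<^esub> f [^]\<^bsub>?K\<^esub> k"
    using x unfolding pow by (intro dividesI[of y]) auto
  then show ?thesis
    using B.factorization_in_prime_divisor_system[OF fin sys, of x k] f x \<open>x \<noteq> \<zero>\<close>
      monomial_eq_finprod_subdomain(1)[OF sub B.domain_axioms p] by auto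
qed

text \<open>
  Let \<open>q = a / f^k\<close>. The hypothesis says that \<open>q\<close> becomes a unit once \<open>f\<close> is inverted: from
  \<open>q (b / f^l) = f\<close> one gets \<open>a b = f^(k + l + 1)\<close>, so the prime factors of \<open>a\<close> are among the
  \<open>p i\<close>. The same holds for \<open>f\<close>, and \<open>q\<close> is the quotient of two monomials, whose exponents may now
  be negative.
\<close>
lemma quotient_by_power_eq_monomial:
  assumes sub: "B \<subseteq> carrier R" and fact: "factorial_domain (R\<lparr>carrier := B\<rparr>)" and fin: "finite I"
    and sys: "prime_divisor_system (mult_of (R\<lparr>carrier := B\<rparr>)) f I p"
    and f: "f \<in> B - {\<zero>}" and ab: "a \<in> B" "b \<in> B"
    and prod: "(a \<otimes> inv (f [^] (k :: nat))) \<otimes> (b \<otimes> inv (f [^] (l :: nat))) = f"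
  shows "\<exists>u\<in>Units (R\<lparr>carrier := B\<rparr>). \<exists>e. a \<otimes> inv (f [^] k) = u \<otimes> monomial (units_of R) I p e"
proof -
  interpret B: factorial_domain "R\<lparr>carrier := B\<rparr>" by fact
  interpret G: comm_group "units_of R" by (rule units_of_comm_group)
  note U = subdomain_units_subgroup[OF sub B.domain_axioms]
  have fR: "f \<in> carrier R" "f \<noteq> \<zero>" and abR: "a \<in> carrier R" "b \<in> carrier R"
    using f ab sub by auto
  have unit: "f [^] (j :: nat) \<in> Units R" for j
    using fR Units_pow_closed[of f j] field_Units by auto
  have fG: "f \<in> carrier (units_of R)" using fR by (simp add: carrier_units_of)
  have powB: "f [^] (j :: nat) \<in> B" for j
    using B.nat_pow_closed[of f j] f by (simp add: nat_pow_def)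
  have powG: "f [^] (j :: nat) = f [^]\<^bsub>units_of R\<^esub> int j" for j
    by (simp add: int_pow_int nat_pow_def units_of_mult units_of_one)
  have p: "p \<in> I \<rightarrow> B - {\<zero>}" using sys unfolding prime_divisor_system_def by simp
  then have pG: "p \<in> I \<rightarrow> carrier (units_of R)" using sub by (auto simp: carrier_units_of)
  have "a \<otimes> b = f \<otimes> (f [^] k \<otimes> f [^] l)"
  proof -
    have "f \<otimes> (f [^] k \<otimes> f [^] l)
        = ((a \<otimes> inv (f [^] k)) \<otimes> (b \<otimes> inv (f [^] l))) \<otimes> (f [^] k \<otimes> f [^] l)"
      by (simp only: prod)
    also have "\<dots> = (a \<otimes> b) \<otimes> ((inv (f [^] k) \<otimes> f [^] k) \<otimes> (inv (f [^] l) \<otimes> f [^] l))"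
      using abR fR Units_inv_closed[OF unit] by (simp add: m_ac)
    finally have "f \<otimes> (f [^] k \<otimes> f [^] l)
        = (a \<otimes> b) \<otimes> ((inv (f [^] k) \<otimes> f [^] k) \<otimes> (inv (f [^] l) \<otimes> f [^] l))" .
    then show ?thesis using unit abR Units_l_inv by simp
  qed
  also have "\<dots> = f [^] (Suc (k + l))"
    using fR by (simp add: nat_pow_mult m_comm)
  finally obtain u c where a: "u \<in> Units (R\<lparr>carrier := B\<rparr>)"
      "a = u \<otimes> monomial (units_of R) I p (\<lambda>i. int (c i))"
    using divisor_of_power_eq_monomial[OF sub fact fin sys f ab] by blast
  have "f \<otimes> \<one> = f [^] (1 :: nat)" "\<one> \<in> B" using fR B.one_closed by auto
  then obtain v d where v: "v \<in> Units (R\<lparr>carrier := B\<rparr>)"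
      "f = v \<otimes> monomial (units_of R) I p (\<lambda>i. int (d i))"
    using divisor_of_power_eq_monomial[OF sub fact fin sys f, of f \<one> 1] f by blast
  have uG: "u \<in> carrier (units_of R)" and vG: "v \<in> carrier (units_of R)"
    using a v subgroup.mem_carrier[OF U] by auto
  let ?m = "monomial (units_of R) I p"
  have m: "?m e \<in> carrier (units_of R)" for e by (rule G.monomial_closed[OF pG])
  have vk: "v [^]\<^bsub>units_of R\<^esub> int k \<in> Units (R\<lparr>carrier := B\<rparr>)"
    by (rule G.int_pow_subgroup_closed[OF U v(1)])
  define w where "w = u \<otimes>\<^bsub>units_of R\<^esub> inv\<^bsub>units_of R\<^esub> (v [^]\<^bsub>units_of R\<^esub> int k)"
  have w: "w \<in> Units (R\<lparr>carrier := B\<rparr>)"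
    unfolding w_def using subgroup.m_closed[OF U a(1)] subgroup.m_inv_closed[OF U vk] by blast
  have "f [^] k = v [^]\<^bsub>units_of R\<^esub> int k \<otimes>\<^bsub>units_of R\<^esub> ?m (\<lambda>i. int k * int (d i))"
    using v(2) G.int_pow_distrib[OF vG m] G.monomial_scale[OF pG]
    unfolding powG by (simp add: units_of_mult)
  moreover have "inv (f [^] k) = inv\<^bsub>units_of R\<^esub> (f [^] k)"
    using units_of_inv[OF unit] by simp
  ultimately have "a \<otimes> inv (f [^] k)
      = (u \<otimes>\<^bsub>units_of R\<^esub> ?m (\<lambda>i. int (c i))) \<otimes>\<^bsub>units_of R\<^esub> inv\<^bsub>units_of R\<^esub>
          (v [^]\<^bsub>units_of R\<^esub> int k \<otimes>\<^bsub>units_of R\<^esub> ?m (\<lambda>i. int k * int (d i)))"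
    using a(2) by (simp add: units_of_mult)
  also have "\<dots> = w \<otimes>\<^bsub>units_of R\<^esub> (?m (\<lambda>i. int (c i))
      \<otimes>\<^bsub>units_of R\<^esub> inv\<^bsub>units_of R\<^esub> ?m (\<lambda>i. int k * int (d i)))"
    unfolding w_def using uG vG m by (simp add: G.inv_mult G.m_ac)
  also have "\<dots> = w \<otimes> ?m (\<lambda>i. int (c i) - int k * int (d i))"
    using G.monomial_diff[OF pG, of "\<lambda>i. int (c i)" "\<lambda>i. int k * int (d i)"]
    by (simp add: units_of_mult)
  finally have "a \<otimes> inv (f [^] k) = w \<otimes> ?m (\<lambda>i. int (c i) - int k * int (d i))" .
  then show ?thesis using w by blast
qed

end

lemma primeideal_contraction:
  assumes R: "cring R" and R': "cring R'" and hom: "id \<in> Ring.ring_hom R R'" and Q: "primeideal Q R'"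
  shows "primeideal (contraction (carrier R) Q) R"
proof -
  have "ring_hom_ring R R' id"
    using R R' hom by (intro ring_hom_ringI2) (auto dest: cring.axioms)
  then have "primeideal {r \<in> carrier R. id r \<in> Q} R"
    by (rule ring_hom_ring.primeideal_vimage[OF _ R Q])
  also have "{r \<in> carrier R. id r \<in> Q} = contraction (carrier R) Q"
    by (auto simp: contraction_def)
  finally show ?thesis .
qed

text \<open>
  The preimage of the zero locus of \<open>f\<close> under the morphism of spectra is the zero locus of \<open>f\<close>
  upstairs, because the contraction of a prime is always a prime.
\<close>
lemma contraction_vimage_zero_locus:
  assumes R: "cring R" and R': "cring R'" and hom: "id \<in> Ring.ring_hom R R'" and f: "f \<in> carrier R"
  shows "{Q \<in> spec R'. contraction (carrier R) Q \<in> zero_locus R f} = zero_locus R' f"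
  using primeideal_contraction[OF R R' hom] f
  by (auto simp: zero_locus_def spec_def contraction_def)

lemma affine_modification_quotient:
  assumes "cring (F\<lparr>carrier := A\<rparr>)" "ideal I (F\<lparr>carrier := A\<rparr>)" "x \<in> affine_modification F A I f"
  shows "\<exists>a\<in>A. \<exists>k :: nat. x = a \<otimes>\<^bsub>F\<^esub> inv\<^bsub>F\<^esub> (f [^]\<^bsub>F\<^esub> k)"
proof -
  let ?R = "F\<lparr>carrier := A\<rparr>"
  interpret ideals: comm_monoid "ideals_set ?R"
    by (rule cring.ideals_set_is_comm_monoid[OF assms(1)])
  have "ideal (I [^]\<^bsub>ideals_set ?R\<^esub> (k :: nat)) ?R" for k
    using ideals.nat_pow_closed[of I k] assms(2) by (simp add: ideals_set_def)
  then have "I [^]\<^bsub>ideals_set ?R\<^esub> (k :: nat) \<subseteq> A" for k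
    using ideal.Icarr by fastforce
  then show ?thesis
    using assms(3) unfolding affine_modification_def by blast
qed

lemma subset_affine_modification:
  assumes "field F" "A \<subseteq> carrier F"
  shows "A \<subseteq> affine_modification F A I f"
proof
  interpret F: field F by fact
  fix a assume a: "a \<in> A"
  then have "a = a \<otimes>\<^bsub>F\<^esub> inv\<^bsub>F\<^esub> (f [^]\<^bsub>F\<^esub> (0 :: nat))" using assms(2) by auto
  moreover have "a \<in> I [^]\<^bsub>ideals_set (F\<lparr>carrier := A\<rparr>)\<^esub> (0 :: nat)"
    using a by (simp add: ideals_set_def)
  ultimately show "a \<in> affine_modification F A I f"
    unfolding affine_modification_def by blast
qed

theorem proposition1p3:
  fixes F :: "('a, 'b) ring_scheme"
    and \<phi> :: "complex \<Rightarrow> 'a"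
    and A A' I :: "'a set"
    and f :: 'a
    and R R' :: "('a, 'b) ring_scheme"
    and n n' :: nat
    and D E :: "nat \<Rightarrow> 'a set set"
  assumes frac: "is_fraction_field_of F A"
    and R: "R = F\<lparr>carrier := A\<rparr>"
    and Y: "affine_variety_algebra R \<phi>"
    and I: "ideal I R" "I \<noteq> {\<zero>\<^bsub>F\<^esub>}" "I \<noteq> A"
    and f: "f \<in> I" "f \<noteq> \<zero>\<^bsub>F\<^esub>"
    and A': "A' = affine_modification F A I f"
    and R': "R' = F\<lparr>carrier := A'\<rparr>"
    and D: "bij_betw D {..<n} (irreducible_components (zariski R) (zero_locus R f))"
    and E: "bij_betw E {..<n'} (irreducible_components (zariski R')
              {Q \<in> spec R'. contraction A Q \<in> zero_locus R f})"
    and D_Cartier: "\<And>i. i < n \<Longrightarrow> effective_cartier R (vanishing_ideal R (D i))"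
    and E_Cartier: "\<And>j. j < n' \<Longrightarrow> effective_cartier R' (vanishing_ideal R' (E j))"
    and UFD: "factorial_domain R" "factorial_domain R'"
    and units: "Units R = Units R'"
  shows "n = n' \<and> invertible_mat (multiplicity_matrix R R' n D n' E)"
proof -
  interpret F: field F using frac unfolding is_fraction_field_of_def by blast
  interpret R: factorial_domain R by (rule UFD(1))
  interpret R': factorial_domain R' by (rule UFD(2))
  let ?G = "units_of F"
  interpret G: comm_group ?G by (rule F.units_of_comm_group)
  have carr: "carrier R = A" "carrier R' = A'" "monoid.mult R = monoid.mult F"
    "monoid.mult R' = monoid.mult F"
    "\<zero>\<^bsub>R\<^esub> = \<zero>\<^bsub>F\<^esub>" "\<zero>\<^bsub>R'\<^esub> = \<zero>\<^bsub>F\<^esub>" "\<one>\<^bsub>R\<^esub> = \<one>\<^bsub>F\<^esub>" "\<one>\<^bsub>R'\<^esub> = \<one>\<^bsub>F\<^esub>"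
    "ring.add R = ring.add F" "ring.add R' = ring.add F"
    unfolding R R' by simp_all
  have AF: "A \<subseteq> carrier F"
    using frac subringE(1) unfolding is_fraction_field_of_def by metis
  have fA: "f \<in> A" using f(1) I(1) ideal.Icarr carr by metis
  have AA': "A \<subseteq> A'"
    unfolding A' by (rule subset_affine_modification[OF F.field_axioms AF])
  have quot: "\<exists>a\<in>A. \<exists>k :: nat. x = a \<otimes>\<^bsub>F\<^esub> inv\<^bsub>F\<^esub> (f [^]\<^bsub>F\<^esub> k)" if "x \<in> A'" for x
    using affine_modification_quotient[where F = F and A = A and I = I and x = x and f = f]
      that A' I(1) R.cring_axioms R by simp
  have A'F: "A' \<subseteq> carrier F"
  proof
    fix x assume "x \<in> A'"
    then obtain a k where x: "a \<in> A" "x = a \<otimes>\<^bsub>F\<^esub> inv\<^bsub>F\<^esub> (f [^]\<^bsub>F\<^esub> (k :: nat))"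
      using quot by blast
    have "f \<in> Units F" using fA f(2) AF F.field_Units by blast
    then show "x \<in> carrier F"
      using x AF F.Units_inv_closed[OF F.Units_pow_closed] by blast
  qed
  have id_hom: "id \<in> Ring.ring_hom R R'"
    using AA' carr by (intro ring_hom_memI) auto
  have E_locus: "bij_betw E {..<n'} (irreducible_components (zariski R') (zero_locus R' f))"
    using E contraction_vimage_zero_locus[OF R.cring_axioms R'.cring_axioms id_hom, of f] carr fA
    by simp
  have fR: "f \<in> carrier (mult_of R)" and fR': "f \<in> carrier (mult_of R')"
    using fA AA' f(2) carr by auto
  obtain p where p: "prime_divisor_system (mult_of R) f {..<n} p"
      "\<And>i. i < n \<Longrightarrow> vanishing_ideal R (D i) = PIdl\<^bsub>R\<^esub> (p i)"
    using R.prime_equations_of_components[OF fR D] by blast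
  obtain q where q: "prime_divisor_system (mult_of R') f {..<n'} q"
      "\<And>j. j < n' \<Longrightarrow> vanishing_ideal R' (E j) = PIdl\<^bsub>R'\<^esub> (q j)"
    using R'.prime_equations_of_components[OF fR' E_locus] by blast
  have pA: "p \<in> {..<n} \<rightarrow> A - {\<zero>\<^bsub>F\<^esub>}" and qA': "q \<in> {..<n'} \<rightarrow> A' - {\<zero>\<^bsub>F\<^esub>}"
    using p(1) q(1) carr unfolding prime_divisor_system_def by auto
  then have pG: "p \<in> {..<n} \<rightarrow> carrier ?G" and qG: "q \<in> {..<n'} \<rightarrow> carrier ?G"
    using AF A'F by (auto simp: F.carrier_units_of)
  have fF: "f [^]\<^bsub>F\<^esub> (1 :: nat) = f" using fA AF by auto
  \<comment> \<open>\<open>p i\<close> divides \<open>f\<close>, also in \<open>A'\<close>, so its prime factors there are among the \<open>q j\<close>\<close>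
  have "\<exists>u\<in>Units R'. \<exists>m :: nat \<Rightarrow> nat. p i = u \<otimes>\<^bsub>F\<^esub> monomial ?G {..<n'} q (\<lambda>j. int (m j))"
    if i: "i < n" for i
  proof -
    have "p i divides\<^bsub>mult_of R\<^esub> f"
      using p(1) i unfolding prime_divisor_system_def by auto
    then obtain y where y: "y \<in> A" "p i \<otimes>\<^bsub>F\<^esub> y = f"
      using carr by (auto simp: factor_def)
    then show ?thesis
      using F.divisor_of_power_eq_monomial[OF A'F, of "{..<n'}" f q "p i" y 1]
        UFD(2) q(1) fR' AA' i pA fF carr R' by auto
  qed
  then obtain m :: "nat \<Rightarrow> nat \<Rightarrow> nat" where m: "\<And>i. i < n \<Longrightarrow>
      \<exists>u\<in>Units R'. p i = u \<otimes>\<^bsub>F\<^esub> monomial ?G {..<n'} q (\<lambda>j. int (m i j))"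
    by metis
  \<comment> \<open>\<open>q j\<close> divides \<open>f\<close> in \<open>A'\<close>, and both \<open>q j\<close> and its cofactor have a power of \<open>f\<close> as denominator\<close>
  have "\<exists>u\<in>Units R. \<exists>e. q j = u \<otimes>\<^bsub>F\<^esub> monomial ?G {..<n} p e" if j: "j < n'" for j
  proof -
    have "q j divides\<^bsub>mult_of R'\<^esub> f"
      using q(1) j unfolding prime_divisor_system_def by auto
    then obtain y where y: "y \<in> A'" "q j \<otimes>\<^bsub>F\<^esub> y = f"
      using carr by (auto simp: factor_def)
    obtain a k where a: "a \<in> A" "q j = a \<otimes>\<^bsub>F\<^esub> inv\<^bsub>F\<^esub> (f [^]\<^bsub>F\<^esub> (k :: nat))"
      using quot[of "q j"] qA' j by auto
    obtain b l where b: "b \<in> A" "y = b \<otimes>\<^bsub>F\<^esub> inv\<^bsub>F\<^esub> (f [^]\<^bsub>F\<^esub> (l :: nat))"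
      using quot[OF y(1)] by auto
    show ?thesis
      using F.quotient_by_power_eq_monomial[OF AF, of "{..<n}" f p a b k l]
        UFD(1) p(1) fR carr R a b y by auto
  qed
  then obtain N where N: "\<And>j. j < n' \<Longrightarrow>
      \<exists>u\<in>Units R. q j = u \<otimes>\<^bsub>F\<^esub> monomial ?G {..<n} p (N j)"
    by metis
  have U: "subgroup (Units R) ?G"
    using F.subdomain_units_subgroup[OF AF] R.domain_axioms R by simp
  have indep_p: "independent_modulo ?G (Units R) {..<n} p"
    using F.prime_divisor_system_independent[OF AF, of "{..<n}" f p] R.domain_axioms p(1) R by simp
  have indep_q: "independent_modulo ?G (Units R) {..<n'} q"
    using F.prime_divisor_system_independent[OF A'F, of "{..<n'}" f q] R'.domain_axioms q(1) R' units
    by simp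
  \<comment> \<open>both families are independent modulo the common group of units, so each matrix inverts the other\<close>
  have MN: "(\<Sum>j<n'. int (m i j) * N j k) = (if i = k then 1 else 0)" if "i < n" "k < n" for i k
    using m N units that
    by (intro G.change_of_basis_inverse[OF U _ _ pG qG indep_p]) (auto simp: units_of_mult)
  have NM: "(\<Sum>i<n. N j i * int (m i l)) = (if j = l then 1 else 0)" if "j < n'" "l < n'" for j l
    using m N units that
    by (intro G.change_of_basis_inverse[OF U _ _ qG pG indep_q, of N "\<lambda>i j. int (m i j)"])
      (auto simp: units_of_mult)
  have "\<exists>u\<in>Units R'. p i = u \<otimes>\<^bsub>R'\<^esub> finprod R' (\<lambda>j. q j [^]\<^bsub>R'\<^esub> m i j) {..<n'}" if "i < n" for i
    using m[OF that] F.monomial_eq_finprod_subdomain(2)[OF A'F _ qA'] R'.domain_axioms R' by simp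
  then have "multiplicity_matrix R R' n D n' E = Matrix.mat n n' (\<lambda>(i, j). int (m i j))"
    using R.domain_axioms R'.domain_axioms AA' carr p q pA
    by (intro multiplicity_matrix_eqI[where p = p and q = q and f = f]) auto
  then show ?thesis
    using mutually_inverse_imp_invertible_mat[OF MN NM] by simp
qed

end
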